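(* Let $W$ be a finite Coxeter group with set of reflections $T$, let $H$ be a subgroup of $W$, and let $X = W/H$ be the set of left cosets of $H$ in $W$. Then $H$ is a modular subgroup of $W$ if and only if $W_T(q) = H_T(q) \cdot X_T(q)$.
   Context: $(W,S)$ is a Coxeter system and $T = \{wsw^{-1} : w \in W, s \in S\}$. For $w \in W$, $\ell_T(w)$ is the minimum $k$ such that $w$ is a product of $k$ elements of $T$. The absolute order $\mathrm{Abs}(W) = (W,\le_T)$ is defined by $u \le_T v$ iff $\ell_T(vu^{-1}) = \ell_T(v) - \ell_T(u)$. A subgroup $H$ of $W$ is modular if every left coset of $H$ in $W$ has a minimum element in $\mathrm{Abs}(W)$ (i.e. an element $w_\circ$ of the coset with $w_\circ \le_T w$ for every $w$ in the coset). For $x \in X = W/H$ put $\ell_T(x) := \min\{\ell_T(w) : w \in x\}$. The polynomials are $W_T(q) := \sum_{w \in W} q^{\ell_T(w)}$, $H_T(q) := \sum_{h \in H} q^{\ell_T(h)}$ (with $\ell_T$ the absolute length in $W$) and $X_T(q) := \sum_{x \in X} q^{\ell_T(x)}$. *)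

theory Defs
  imports
    "HOL-Algebra.Left_Coset"
    "HOL-Algebra.Generated_Groups"
    "HOL-Computational_Algebra.Polynomial"
    "HOL-Library.Extended_Nat"
begin

text \<open>
  Group presentations. A word over \<open>S\<close> is a list of pairs \<open>(b, s)\<close> with \<open>s \<in> S\<close>, where
  \<open>(True, s)\<close> stands for \<open>s\<close> and \<open>(False, s)\<close> for the formal inverse of \<open>s\<close>. Two words represent
  the same element of the group presented by generators \<open>S\<close> and relators \<open>R\<close> iff they are related
  by the equivalence closure of inserting a cancelling pair or a relator at any position.
\<close>

type_synonym 'a gen_word = "(bool \<times> 'a) list"

inductive pres_insert :: "'a set \<Rightarrow> 'a gen_word set \<Rightarrow> 'a gen_word \<Rightarrow> 'a gen_word \<Rightarrow> bool"
  for S :: "'a set" and R :: "'a gen_word set"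
where
  cancel: "s \<in> S \<Longrightarrow> pres_insert S R (u @ v) (u @ [(b, s), (\<not> b, s)] @ v)"
| relator: "r \<in> R \<Longrightarrow> pres_insert S R (u @ v) (u @ r @ v)"

definition pres_equiv :: "'a set \<Rightarrow> 'a gen_word set \<Rightarrow> 'a gen_word \<Rightarrow> 'a gen_word \<Rightarrow> bool"
  where "pres_equiv S R = equivclp (pres_insert S R)"

definition eval_word :: "('a, 'b) monoid_scheme \<Rightarrow> 'a gen_word \<Rightarrow> 'a"
  where "eval_word G w =
    foldr (\<otimes>\<^bsub>G\<^esub>) (map (\<lambda>(b, s). if b then s else inv\<^bsub>G\<^esub> s) w) \<one>\<^bsub>G\<^esub>"

definition has_presentation :: "('a, 'b) monoid_scheme \<Rightarrow> 'a set \<Rightarrow> 'a gen_word set \<Rightarrow> bool"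
  where "has_presentation G S R \<longleftrightarrow>
    group G \<and> S \<subseteq> carrier G \<and> generate G S = carrier G \<and>
    (\<forall>w. set w \<subseteq> UNIV \<times> S \<longrightarrow> (eval_word G w = \<one>\<^bsub>G\<^esub> \<longleftrightarrow> pres_equiv S R w []))"

definition coxeter_matrix :: "'a set \<Rightarrow> ('a \<Rightarrow> 'a \<Rightarrow> enat) \<Rightarrow> bool"
  where "coxeter_matrix S m \<longleftrightarrow>
    (\<forall>s\<in>S. m s s = 1) \<and>
    (\<forall>s\<in>S. \<forall>t\<in>S. m s t = m t s) \<and>
    (\<forall>s\<in>S. \<forall>t\<in>S. s \<noteq> t \<longrightarrow> 2 \<le> m s t)"

text \<open>
  The relators \<open>(s t)\<^sup>k\<close> with \<open>k = m s t\<close> finite; those with \<open>s = t\<close> are the words \<open>s s\<close>.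
\<close>

definition coxeter_relators :: "'a set \<Rightarrow> ('a \<Rightarrow> 'a \<Rightarrow> enat) \<Rightarrow> 'a gen_word set"
  where "coxeter_relators S m =
    {concat (replicate k [(True, s), (True, t)]) | s t k. s \<in> S \<and> t \<in> S \<and> m s t = enat k}"

definition coxeter_system :: "('a, 'b) monoid_scheme \<Rightarrow> 'a set \<Rightarrow> bool"
  where "coxeter_system W S \<longleftrightarrow>
    (\<exists>m. coxeter_matrix S m \<and> has_presentation W S (coxeter_relators S m))"

definition reflections :: "('a, 'b) monoid_scheme \<Rightarrow> 'a set \<Rightarrow> 'a set"
  where "reflections W S = {w \<otimes>\<^bsub>W\<^esub> s \<otimes>\<^bsub>W\<^esub> inv\<^bsub>W\<^esub> w | w s. w \<in> carrier W \<and> s \<in> S}"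

definition abs_length :: "('a, 'b) monoid_scheme \<Rightarrow> 'a set \<Rightarrow> 'a \<Rightarrow> nat"
  where "abs_length W S w =
    (LEAST k. \<exists>ts. length ts = k \<and> set ts \<subseteq> reflections W S \<and> foldr (\<otimes>\<^bsub>W\<^esub>) ts \<one>\<^bsub>W\<^esub> = w)"

definition abs_le :: "('a, 'b) monoid_scheme \<Rightarrow> 'a set \<Rightarrow> 'a \<Rightarrow> 'a \<Rightarrow> bool"
  where "abs_le W S u v \<longleftrightarrow>
    u \<in> carrier W \<and> v \<in> carrier W \<and>
    int (abs_length W S (v \<otimes>\<^bsub>W\<^esub> inv\<^bsub>W\<^esub> u)) = int (abs_length W S v) - int (abs_length W S u)"

definition modular_subgroup :: "('a, 'b) monoid_scheme \<Rightarrow> 'a set \<Rightarrow> 'a set \<Rightarrow> bool"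
  where "modular_subgroup W S H \<longleftrightarrow>
    subgroup H W \<and> (\<forall>x \<in> lcosets\<^bsub>W\<^esub> H. \<exists>w0\<in>x. \<forall>w\<in>x. abs_le W S w0 w)"

definition coset_abs_length :: "('a, 'b) monoid_scheme \<Rightarrow> 'a set \<Rightarrow> 'a set \<Rightarrow> nat"
  where "coset_abs_length W S x = (LEAST k. k \<in> abs_length W S ` x)"

text \<open>
  \<open>abs_poly W S (carrier W)\<close> is $W_T(q)$ and \<open>abs_poly W S H\<close> is $H_T(q)$: the length is always the
  one in \<open>W\<close>.
\<close>

definition abs_poly :: "('a, 'b) monoid_scheme \<Rightarrow> 'a set \<Rightarrow> 'a set \<Rightarrow> int poly"
  where "abs_poly W S A = (\<Sum>w\<in>A. monom 1 (abs_length W S w))"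

definition coset_abs_poly :: "('a, 'b) monoid_scheme \<Rightarrow> 'a set \<Rightarrow> 'a set \<Rightarrow> int poly"
  where "coset_abs_poly W S H = (\<Sum>x \<in> lcosets\<^bsub>W\<^esub> H. monom 1 (coset_abs_length W S x))"

end

theory Submission
  imports Defs "HOL-Algebra.Divisibility"
begin

text \<open>
  Since the absolute length is subadditive and invariant under conjugation, \<open>w\<^sub>0 \<le>\<^sub>T w\<^sub>0 h\<close> means
  that \<open>\<ell>\<^sub>T(w\<^sub>0 h) = \<ell>\<^sub>T(w\<^sub>0) + \<ell>\<^sub>T(h)\<close>, where in general only \<open>\<le>\<close> holds. If every coset has a
  minimum element, summing over the cosets gives the factorization. Conversely, choose an element
  of minimal length in every coset; differentiating the factorization at \<open>q = 1\<close> shows that the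
  inequalities \<open>\<ell>\<^sub>T(w\<^sub>0 h) \<le> \<ell>\<^sub>T(w\<^sub>0) + \<ell>\<^sub>T(h)\<close> add up to an equality, so each of them is one.
\<close>

section \<open>Products of lists of group elements\<close>

lemma (in monoid) foldr_mult_append:
  assumes "set xs \<subseteq> carrier G" "set ys \<subseteq> carrier G"
  shows "foldr (\<otimes>) (xs @ ys) \<one> = foldr (\<otimes>) xs \<one> \<otimes> foldr (\<otimes>) ys \<one>"
  using assms by (induction xs) (simp_all add: m_assoc multlist_closed)

lemma (in group) foldr_mult_conjugate:
  assumes "set xs \<subseteq> carrier G" "g \<in> carrier G"
  shows "foldr (\<otimes>) (map (\<lambda>x. g \<otimes> x \<otimes> inv g) xs) \<one> = g \<otimes> foldr (\<otimes>) xs \<one> \<otimes> inv g"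
  using assms
proof (induction xs)
  case (Cons x xs)
  have "inv g \<otimes> (g \<otimes> y) = y" if "y \<in> carrier G" for y
    using that Cons.prems by (simp flip: m_assoc)
  then show ?case
    using Cons by (simp add: m_assoc multlist_closed)
qed simp

text \<open>Isolates what the argument uses of a Coxeter system. The second assumption makes the
  \<open>LEAST\<close> in \<open>abs_length\<close> range over a nonempty set, so that shortest
  factorizations exist.\<close>

locale reflection_generated = group W for W (structure) +
  fixes S
  assumes generators_closed: "S \<subseteq> carrier W"
    and reflection_factorization:
      "w \<in> carrier W \<Longrightarrow> \<exists>ts. set ts \<subseteq> reflections W S \<and> foldr (\<otimes>) ts \<one> = w"
begin

lemma reflections_closed: "reflections W S \<subseteq> carrier W"
  using generators_closed by (auto simp: reflections_def)

lemma reflections_conjugate: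
  assumes "t \<in> reflections W S" "g \<in> carrier W"
  shows "g \<otimes> t \<otimes> inv g \<in> reflections W S"
proof -
  obtain w s where ws: "w \<in> carrier W" "s \<in> S" "t = w \<otimes> s \<otimes> inv w"
    using assms(1) unfolding reflections_def by blast
  then have "g \<otimes> t \<otimes> inv g = (g \<otimes> w) \<otimes> s \<otimes> inv (g \<otimes> w)"
    using assms(2) generators_closed by (auto simp: m_assoc inv_mult_group)
  then show ?thesis
    unfolding reflections_def using ws assms(2) by blast
qed

section \<open>Subadditivity and conjugation invariance of the absolute length\<close>

lemma abs_length_witness:
  assumes "w \<in> carrier W"
  obtains ts where "length ts = abs_length W S w" "set ts \<subseteq> reflections W S"
    "foldr (\<otimes>) ts \<one> = w"
proof -
  have "\<exists>k ts. length ts = k \<and> set ts \<subseteq> reflections W S \<and> foldr (\<otimes>) ts \<one> = w"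
    using reflection_factorization[OF assms] by blast
  from LeastI_ex[OF this] that show thesis
    unfolding abs_length_def by blast
qed

lemma abs_length_le:
  assumes "set ts \<subseteq> reflections W S" "foldr (\<otimes>) ts \<one> = w"
  shows "abs_length W S w \<le> length ts"
  unfolding abs_length_def using assms by (intro Least_le) blast

lemma abs_length_mult_le:
  assumes "u \<in> carrier W" "v \<in> carrier W"
  shows "abs_length W S (u \<otimes> v) \<le> abs_length W S u + abs_length W S v"
proof -
  obtain us where us: "length us = abs_length W S u" "set us \<subseteq> reflections W S"
    "foldr (\<otimes>) us \<one> = u" using abs_length_witness[OF assms(1)] .
  obtain vs where vs: "length vs = abs_length W S v" "set vs \<subseteq> reflections W S"
    "foldr (\<otimes>) vs \<one> = v" using abs_length_witness[OF assms(2)] .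
  have "foldr (\<otimes>) (us @ vs) \<one> = u \<otimes> v"
    using foldr_mult_append[of us vs] us vs reflections_closed by blast
  then show ?thesis
    using abs_length_le[of "us @ vs"] us vs by simp
qed

text \<open>Conjugating a shortest factorization term by term gives reflections again, and equally
  many.\<close>

lemma abs_length_conjugate_le:
  assumes "w \<in> carrier W" "g \<in> carrier W"
  shows "abs_length W S (g \<otimes> w \<otimes> inv g) \<le> abs_length W S w"
proof -
  obtain ts where ts: "length ts = abs_length W S w" "set ts \<subseteq> reflections W S"
    "foldr (\<otimes>) ts \<one> = w" using abs_length_witness[OF assms(1)] .
  have "foldr (\<otimes>) (map (\<lambda>t. g \<otimes> t \<otimes> inv g) ts) \<one> = g \<otimes> w \<otimes> inv g"
    using foldr_mult_conjugate[of ts g] ts reflections_closed assms by blast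
  moreover have "set (map (\<lambda>t. g \<otimes> t \<otimes> inv g) ts) \<subseteq> reflections W S"
    using ts reflections_conjugate assms by auto
  ultimately show ?thesis
    using abs_length_le ts(1) by fastforce
qed

lemma abs_length_conjugate:
  assumes "w \<in> carrier W" "g \<in> carrier W"
  shows "abs_length W S (g \<otimes> w \<otimes> inv g) = abs_length W S w"
proof (rule antisym)
  have "inv g \<otimes> (g \<otimes> w \<otimes> inv g) \<otimes> inv (inv g) = w"
    using assms by (metis inv_closed inv_inv l_inv m_assoc m_closed r_one l_one)
  then show "abs_length W S w \<le> abs_length W S (g \<otimes> w \<otimes> inv g)"
    using abs_length_conjugate_le[of "g \<otimes> w \<otimes> inv g" "inv g"] assms by simp
qed (rule abs_length_conjugate_le[OF assms])

text \<open>The order compares along \<open>v \<otimes> inv u\<close>, while left cosets multiply on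
  the right. For \<open>v = w \<otimes> h\<close> and \<open>u = w\<close> the quotient is the
  conjugate \<open>w \<otimes> h \<otimes> inv w\<close>, which has the length of
  \<open>h\<close>.\<close>

lemma abs_le_mult_iff:
  assumes "w \<in> carrier W" "h \<in> carrier W"
  shows "abs_le W S w (w \<otimes> h) \<longleftrightarrow> abs_length W S (w \<otimes> h) = abs_length W S w + abs_length W S h"
  using assms abs_length_conjugate[of h w] by (auto simp: abs_le_def)

section \<open>Left cosets and their generating functions\<close>

lemma lcosets_eq:
  assumes "subgroup H W" "x \<in> lcosets H" "w \<in> x"
  shows "w \<in> carrier W" "x = w <# H"
  using assms subgroup.lcosets_carrier[OF assms(1) group_axioms assms(2)] l_repr_independence
  by (auto simp: LCOSETS_def)

lemma abs_poly_coset: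
  assumes "subgroup H W" "w \<in> carrier W"
  shows "abs_poly W S (w <# H) = (\<Sum>h\<in>H. monom 1 (abs_length W S (w \<otimes> h)))"
proof -
  have "w <# H = (\<otimes>) w ` H"
    by (auto simp: l_coset_def)
  then show ?thesis
    using inj_on_g'[OF subgroup.subset[OF assms(1)] assms(2)]
    by (simp add: abs_poly_def sum.reindex)
qed

lemma abs_poly_carrier:
  assumes "finite (carrier W)" "subgroup H W"
  shows "abs_poly W S (carrier W) = (\<Sum>x\<in>lcosets H. abs_poly W S x)"
proof -
  have "\<forall>x\<in>lcosets H. finite x"
    using assms subgroup.lcosets_carrier[OF assms(2) group_axioms] finite_subset by blast
  then show ?thesis
    using sum.Union_disjoint[of "lcosets H" "\<lambda>w. monom (1::int) (abs_length W S w)"]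
      lcos_disjoint[OF assms(2)]
    by (simp add: abs_poly_def lcosets_part_G[OF assms(2)])
qed

lemma coset_abs_length_attained:
  assumes "subgroup H W" "x \<in> lcosets H"
  shows "\<exists>w\<in>x. abs_length W S w = coset_abs_length W S x"
proof -
  obtain w where "w \<in> x"
    using assms lcos_self by (auto simp: LCOSETS_def)
  then have "\<exists>k. k \<in> abs_length W S ` x"
    by blast
  from LeastI_ex[OF this] show ?thesis
    unfolding coset_abs_length_def by force
qed

text \<open>A difference of lengths that equals a length is nonnegative, so going down in the
  absolute order cannot increase the length.\<close>

lemma coset_abs_length_minimum:
  assumes "w \<in> x" "\<And>v. v \<in> x \<Longrightarrow> abs_le W S w v"
  shows "coset_abs_length W S x = abs_length W S w"
  unfolding coset_abs_length_def
proof (rule Least_equality)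
  fix k assume "k \<in> abs_length W S ` x"
  then show "abs_length W S w \<le> k"
    using assms(2) by (force simp: abs_le_def)
qed (use assms(1) in blast)

end

text \<open>The derivative of $q^n$ at $q = 1$ is $n$, also for $n = 0$, so the derivative of either
  side at 1 is the sum of its exponents.\<close>

lemma sum_monom_eq_imp_sum_eq:
  fixes f g :: "'i \<Rightarrow> nat"
  assumes "(\<Sum>i\<in>A. monom (1::int) (f i)) = (\<Sum>i\<in>A. monom 1 (g i))"
  shows "sum f A = sum g A"
proof -
  have "poly (pderiv (\<Sum>i\<in>A. monom (1::int) (k i))) 1 = int (sum k A)" for k
    using higher_pderiv_sum[of 1 "\<lambda>i. monom (1::int) (k i)" A]
    by (simp add: pderiv_monom poly_sum poly_monom)
  from this[of f] this[of g] show ?thesis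
    using assms by (simp flip: of_nat_sum)
qed

section \<open>The two directions of the equivalence\<close>

context reflection_generated
begin

lemma modular_imp_abs_poly_factorization:
  assumes "finite (carrier W)" "modular_subgroup W S H"
  shows "abs_poly W S (carrier W) = abs_poly W S H * coset_abs_poly W S H"
proof -
  have H: "subgroup H W"
    using assms(2) by (simp add: modular_subgroup_def)
  have "abs_poly W S x = abs_poly W S H * monom 1 (coset_abs_length W S x)"
    if x: "x \<in> lcosets H" for x
  proof -
    obtain w where w: "w \<in> x" "\<And>v. v \<in> x \<Longrightarrow> abs_le W S w v"
      using assms(2) x unfolding modular_subgroup_def by blast
    note wx = lcosets_eq[OF H x w(1)]
    \<comment> \<open>The minimum \<open>w\<close> lies below \<open>w \<otimes> h\<close>, and its
      length is that of the coset.\<close>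
    have "abs_length W S (w \<otimes> h) = abs_length W S h + coset_abs_length W S x" if "h \<in> H" for h
    proof -
      have "w \<otimes> h \<in> x" "h \<in> carrier W"
        using wx that subgroup.mem_carrier[OF H] by (auto simp: l_coset_def)
      then show ?thesis
        using w wx(1) abs_le_mult_iff coset_abs_length_minimum by fastforce
    qed
    then show ?thesis
      using abs_poly_coset[OF H wx(1)] wx(2)
      by (simp add: abs_poly_def sum_distrib_right mult_monom)
  qed
  then show ?thesis
    using abs_poly_carrier[OF assms(1) H]
    by (simp add: coset_abs_poly_def sum_distrib_left)
qed

lemma abs_poly_factorization_imp_modular:
  assumes "finite (carrier W)" "subgroup H W"
    and "abs_poly W S (carrier W) = abs_poly W S H * coset_abs_poly W S H"
  shows "modular_subgroup W S H"
proof -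
  let ?l = "abs_length W S" and ?c = "coset_abs_length W S"
  obtain r where r: "\<And>x. x \<in> lcosets H \<Longrightarrow> r x \<in> x \<and> ?l (r x) = ?c x"
    using bchoice[of "lcosets H" "\<lambda>x w. w \<in> x \<and> ?l w = ?c x"]
      coset_abs_length_attained[OF assms(2)] by blast
  \<comment> \<open>Both facts carry the premise \<open>x \<in> lcosets H\<close> twice, once from
    \<open>lcosets_eq\<close> and once from \<open>r\<close>; hence \<open>OF x x\<close>
    below.\<close>
  note rx = lcosets_eq[OF assms(2) _ conjunct1[OF r]]
  note H_carrier = subgroup.mem_carrier[OF assms(2)]
  have fin: "finite ((lcosets H) \<times> H)"
    using finite_subset[OF lcosets_subset_PowG[OF assms(2)]]
      finite_subset[OF subgroup.subset[OF assms(2)]] assms(1) by simp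
  \<comment> \<open>Both sides of the factorization are written as sums of monomials over the same
    pairs of a coset and an element of \<open>H\<close>, so that their exponents can be compared
    pair by pair.\<close>
  have "(\<Sum>p\<in>(lcosets H) \<times> H. monom (1::int) (?l (r (fst p) \<otimes> snd p)))
      = (\<Sum>x\<in>lcosets H. abs_poly W S x)"
    unfolding sum.cartesian_product' fst_conv snd_conv
  proof (rule sum.cong[OF refl])
    fix x assume x: "x \<in> lcosets H"
    show "(\<Sum>h\<in>H. monom (1::int) (?l (r x \<otimes> h))) = abs_poly W S x"
      unfolding abs_poly_coset[OF assms(2) rx(1)[OF x x], symmetric]
      using rx(2)[OF x x] by simp
  qed
  also have "\<dots> = coset_abs_poly W S H * abs_poly W S H"
    using assms(3) abs_poly_carrier[OF assms(1,2)] by simp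
  also have "\<dots> = (\<Sum>p\<in>(lcosets H) \<times> H. monom 1 (?c (fst p) + ?l (snd p)))"
    by (simp add: coset_abs_poly_def abs_poly_def sum_product mult_monom sum.cartesian_product')
  finally have sum_eq: "(\<Sum>p\<in>(lcosets H) \<times> H. ?l (r (fst p) \<otimes> snd p))
      = (\<Sum>p\<in>(lcosets H) \<times> H. ?c (fst p) + ?l (snd p))"
    by (rule sum_monom_eq_imp_sum_eq)
  have le: "?l (r (fst p) \<otimes> snd p) \<le> ?c (fst p) + ?l (snd p)" if "p \<in> (lcosets H) \<times> H" for p
  proof -
    from that have x: "fst p \<in> lcosets H" and "snd p \<in> H" by auto
    then show ?thesis
      using abs_length_mult_le[OF rx(1)[OF x x] H_carrier] r[OF x] by simp
  qed
  \<comment> \<open>Termwise inequalities between finite sums with equal totals are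
    equalities.\<close>
  have additive: "?l (r x \<otimes> h) = ?l (r x) + ?l h" if "x \<in> lcosets H" "h \<in> H" for x h
    using sum_mono_inv[OF sum_eq le _ fin, of "(x, h)"] that r[OF that(1)] by simp
  have "abs_le W S (r x) w" if x: "x \<in> lcosets H" and "w \<in> x" for x w
  proof -
    obtain h where "h \<in> H" "w = r x \<otimes> h"
      using \<open>w \<in> x\<close> rx(2)[OF x x] by (auto simp: l_coset_def)
    then show ?thesis
      using additive abs_le_mult_iff[OF rx(1)[OF x x] H_carrier] x by simp
  qed
  then show ?thesis
    unfolding modular_subgroup_def using assms(2) r by blast
qed

end

text \<open>The relator \<open>s s\<close> makes the generators involutions, so no inverses are needed to write an
  element as a product of reflections.\<close>

lemma coxeter_system_reflection_generated:
  assumes "coxeter_system W S"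
  shows "reflection_generated W S"
proof -
  obtain m where m: "coxeter_matrix S m" and pres: "has_presentation W S (coxeter_relators S m)"
    using assms unfolding coxeter_system_def by blast
  interpret group W
    using pres by (simp add: has_presentation_def)
  have S: "S \<subseteq> carrier W" and gen: "generate W S = carrier W"
    using pres by (simp_all add: has_presentation_def)
  have inv_gen: "inv\<^bsub>W\<^esub> s = s" if "s \<in> S" for s
  proof -
    have "m s s = enat 1"
      using m that by (simp add: coxeter_matrix_def one_enat_def)
    then have "concat (replicate 1 [(True, s), (True, s)]) \<in> coxeter_relators S m"
      unfolding coxeter_relators_def using that by blast
    \<comment> \<open>With empty context the relator is inserted into the empty word. This step
      leads from \<open>[]\<close> to the relator, so the symmetric closure is used to reverse
      it.\<close>
    from pres_insert.relator[OF this, of S "[]" "[]"]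
    have "pres_equiv S (coxeter_relators S m) [(True, s), (True, s)] []"
      unfolding pres_equiv_def by (simp add: equivclp_def symclpI2 r_into_rtranclp)
    then have "eval_word W [(True, s), (True, s)] = \<one>\<^bsub>W\<^esub>"
      using pres that by (simp add: has_presentation_def)
    then show ?thesis
      using that S by (intro inv_equality) (auto simp: eval_word_def)
  qed
  have refl: "S \<subseteq> reflections W S"
  proof
    fix s assume "s \<in> S"
    moreover from this have "s = \<one>\<^bsub>W\<^esub> \<otimes>\<^bsub>W\<^esub> s \<otimes>\<^bsub>W\<^esub> inv\<^bsub>W\<^esub> \<one>\<^bsub>W\<^esub>"
      using S by auto
    ultimately show "s \<in> reflections W S"
      unfolding reflections_def by blast
  qed
  \<comment> \<open>Products of generators alone are closed under concatenation and, by
    \<open>inv_gen\<close>, contain the inverses of generators; \<open>refl\<close> then turns them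
    into products of reflections.\<close>
  have "\<exists>ts. set ts \<subseteq> S \<and> foldr (\<otimes>\<^bsub>W\<^esub>) ts \<one>\<^bsub>W\<^esub> = w" if "w \<in> generate W S" for w
    using that
  proof induction
    case one
    show ?case by (rule exI[of _ "[]"]) simp
  next
    case (incl s)
    then show ?case using S by (intro exI[of _ "[s]"]) auto
  next
    case (inv s)
    then show ?case using S inv_gen by (intro exI[of _ "[s]"]) auto
  next
    case (eng u v)
    then obtain us vs where "set us \<subseteq> S" "foldr (\<otimes>\<^bsub>W\<^esub>) us \<one>\<^bsub>W\<^esub> = u"
      "set vs \<subseteq> S" "foldr (\<otimes>\<^bsub>W\<^esub>) vs \<one>\<^bsub>W\<^esub> = v" by blast
    then show ?case
      using S foldr_mult_append[of us vs] by (intro exI[of _ "us @ vs"]) auto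
  qed
  then show ?thesis
    using S gen refl by unfold_locales (auto, meson subset_trans)
qed

theorem proposition3p4:
  fixes W :: "('a, 'b) monoid_scheme" and S H :: "'a set"
  assumes "coxeter_system W S"
    and "finite (carrier W)"
    and "subgroup H W"
  shows "modular_subgroup W S H \<longleftrightarrow>
    abs_poly W S (carrier W) = abs_poly W S H * coset_abs_poly W S H"
proof -
  interpret reflection_generated W S
    by (rule coxeter_system_reflection_generated[OF assms(1)])
  show ?thesis
    using modular_imp_abs_poly_factorization abs_poly_factorization_imp_modular assms(2,3) by blast
qed

end
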